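(* Let $q=p^h$, $p$ prime, $n\ge3$, $1\le k\le n-1$. If $c$ is a codeword of $C_k(n,q)^\perp$ of minimal weight, then $supp(c)$ is contained in an $(n-k+1)$-dimensional subspace of $PG(n,q)$.
   Context: $C_k(n,q)$ is the $p$-ary linear code spanned over $\mathbb{F}_p$ by the rows of the incidence matrix of $k$-dimensional subspaces versus points of $PG(n,q)$; $C_k(n,q)^\perp$ is its dual code with respect to the standard scalar product. $supp(c)$ is the set of points at which $c$ has a nonzero coordinate; minimal weight means minimal among nonzero codewords. *)

theory Defs
  imports "HOL-Analysis.Cartesian_Space" "HOL-Computational_Algebra.Primes"
begin

(* The points of PG(n,q), where 'a is the field of order q and CARD('n) = n + 1. *)
typedef (overloaded) ('a::field, 'n::finite) pg_point =
  "{P :: ('a ^ 'n) set. vec.subspace P \<and> vec.dim P = 1}"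
proof -
  have nz: "axis (undefined :: 'n) (1 :: 'a) \<noteq> 0"
    by (simp add: axis_eq_0_iff)
  have "vec.independent {axis (undefined :: 'n) (1 :: 'a)}"
    using nz by (simp add: vec.independent_insert)
  then have "vec.dim (vec.span {axis (undefined :: 'n) (1 :: 'a)}) = 1"
    by (simp add: vec.dim_eq_card_independent)
  then show ?thesis
    using vec.subspace_span by blast
qed

instance pg_point :: ("{field,finite}", finite) finite
proof
  have "inj (Rep_pg_point :: ('a, 'b) pg_point \<Rightarrow> _)"
    by (simp add: inj_def Rep_pg_point_inject)
  then show "finite (UNIV :: ('a, 'b) pg_point set)"
    by (rule finite_imageD[rotated]) simp
qed

(* A projective subspace of projective dimension d is identified with its set of
   points; the underlying vector space has dimension d + 1. *)
definition pg_subspaces :: "nat \<Rightarrow> ('a::field, 'n::finite) pg_point set set" where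
  "pg_subspaces d =
    {{P. Rep_pg_point P \<subseteq> U} | U. vec.subspace U \<and> vec.dim U = d + 1}"

definition incidence_row :: "'i::finite set \<Rightarrow> 'f::field ^ 'i" where
  "incidence_row S = (\<chi> P. if P \<in> S then 1 else 0)"

(* The code C_k(n,q); 'f is the field of order p. *)
definition pg_code :: "nat \<Rightarrow> ('f::field ^ ('a::{field,finite}, 'n::finite) pg_point) set" where
  "pg_code k = vec.span (incidence_row ` pg_subspaces k)"

definition dual_code :: "('f::field ^ 'i::finite) set \<Rightarrow> ('f ^ 'i) set" where
  "dual_code C = {c. \<forall>v\<in>C. (\<Sum>i\<in>UNIV. c $ i * v $ i) = 0}"

definition supp :: "'f::zero ^ 'i::finite \<Rightarrow> 'i set" where
  "supp c = {i. c $ i \<noteq> 0}"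

definition weight :: "'f::zero ^ 'i::finite \<Rightarrow> nat" where
  "weight c = card (supp c)"

definition minimal_weight_codeword :: "('f::zero ^ 'i::finite) set \<Rightarrow> 'f ^ 'i \<Rightarrow> bool" where
  "minimal_weight_codeword C c \<longleftrightarrow>
    c \<in> C \<and> c \<noteq> 0 \<and> (\<forall>c'\<in>C. c' \<noteq> 0 \<longrightarrow> weight c \<le> weight c')"

end

theory Submission
  imports Defs
begin

text \<open>A codeword \<open>c\<close> is viewed as a function on vectors that is constant on punctured
  one-dimensional subspaces. As \<open>q - 1 = -1\<close> in the field of values, \<open>c\<close> lies in the dual code
  iff this function sums to zero over every vector subspace of dimension \<open>k + 1\<close>.

  Let \<open>c\<close> be of minimal weight with support \<open>S\<close>. Projecting \<open>c\<close> from a point \<open>R\<close> outside \<open>S\<close> onto a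
  hyperplane gives a dual codeword again, of smaller weight if \<open>R\<close> is on a secant of \<open>S\<close>. By
  minimality this projection is then zero, so that no line through \<open>R\<close> is tangent to \<open>S\<close>. Hence the
  union \<open>T\<close> of all secants of \<open>S\<close> is a subspace in which every line through a point of \<open>S\<close> meets
  \<open>S\<close> again. If \<open>T\<close> had projective dimension at least \<open>n - k + 2\<close>, counting these lines would make
  \<open>S\<close> larger than the support of the difference of two \<open>(n - k)\<close>-dimensional subspaces, which is a
  dual codeword.\<close>

section \<open>Subspaces of vector spaces over finite fields\<close>

text \<open>Translation by 1 permutes the ring, so the sum of all \<open>x + 1\<close> equals the
  sum of all \<open>x\<close>; their difference is the cardinality.\<close>

lemma of_nat_CARD_eq_0: "of_nat CARD('f::{ring_1,finite}) = (0::'f)"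
proof -
  have "(\<Sum>x\<in>UNIV. x + 1) = (\<Sum>x\<in>UNIV. (x::'f))"
    by (rule sum.reindex_bij_witness[of _ "\<lambda>x. x - 1" "\<lambda>x. x + 1"]) auto
  then show ?thesis by (simp add: sum.distrib)
qed

lemma CARD_field_ge_2: "2 \<le> CARD('a::{field,finite})"
proof -
  have "card {0, 1 :: 'a} \<le> CARD('a)" by (rule card_mono) auto
  then show ?thesis by simp
qed

lemma dim_UNIV_vec: "vec.dim (UNIV :: ('a::field ^ 'n::finite) set) = CARD('n)"
  by (simp add: card_cart_basis)

lemma span_insert_subspace:
  fixes D :: "('a::field ^ 'n::finite) set"
  assumes "vec.subspace D"
  shows "vec.span (insert x D) = (\<lambda>(d, t). d + t *s x) ` (D \<times> UNIV)"
proof -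
  have "vec.span D = D" using assms by (simp add: vec.span_eq_iff)
  then have "v \<in> vec.span (insert x D) \<longleftrightarrow> (\<exists>d t. d \<in> D \<and> v = d + t *s x)" for v
    by (metis add_diff_cancel_right' diff_add_cancel vec.span_breakdown_eq)
  then show ?thesis
    by (fastforce simp: image_iff)
qed

lemma inj_on_span_insert:
  fixes D :: "('a::field ^ 'n::finite) set"
  assumes D: "vec.subspace D" and x: "x \<notin> D"
  shows "inj_on (\<lambda>(d, t). d + t *s x) (D \<times> UNIV)"
proof (rule inj_onI, clarsimp)
  fix d t d' t'
  assume d: "d \<in> D" "d' \<in> D" and eq: "d + t *s x = d' + t' *s x"
  have *: "(t - t') *s x = d' - d"
    using eq by (simp add: algebra_simps)
  have "t = t'"
  proof (rule ccontr)
    assume "t \<noteq> t'"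
    then have "x = inverse (t - t') *s ((t - t') *s x)"
      by (simp add: vector_smult_assoc)
    also have "\<dots> \<in> D"
      unfolding * using D d by (intro vec.subspace_scale vec.subspace_diff)
    finally show False using x by simp
  qed
  with eq show "d = d' \<and> t = t'" by simp
qed

text \<open>Each vector of the span is \<open>d + t *s x\<close> for exactly one pair. Pencils of
  subspaces and projections from a point are both computed with this splitting.\<close>

lemma sum_span_insert:
  fixes D :: "('a::{field,finite} ^ 'n::finite) set"
  assumes "vec.subspace D" and "x \<notin> D"
  shows "sum F (vec.span (insert x D)) = (\<Sum>d\<in>D. \<Sum>t\<in>UNIV. F (d + t *s x))"
  unfolding span_insert_subspace[OF assms(1)] sum.reindex[OF inj_on_span_insert[OF assms]]
    sum.cartesian_product
  by (auto intro: sum.cong)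

lemma card_span_independent:
  fixes B :: "('a::{field,finite} ^ 'n::finite) set"
  assumes "vec.independent B"
  shows "card (vec.span B) = CARD('a) ^ card B"
proof -
  have "finite B" by simp
  then show ?thesis using assms
  proof (induction B rule: finite_induct)
    case empty
    then show ?case by simp
  next
    case (insert x B)
    then have B: "vec.independent B" "x \<notin> vec.span B"
      by (auto simp: vec.independent_insert)
    have "vec.span (insert x B) = vec.span (insert x (vec.span B))"
      by (simp add: vec.span_insert vec.span_span)
    also have "card \<dots> = (\<Sum>d\<in>vec.span B. \<Sum>t\<in>(UNIV::'a set). 1)"
      using sum_span_insert[OF vec.subspace_span B(2), of "\<lambda>_. 1::nat"] by simp
    finally show ?case using insert B by (simp add: mult.commute)
  qed
qed

lemma card_subspace:
  fixes W :: "('a::{field,finite} ^ 'n::finite) set"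
  assumes "vec.subspace W"
  shows "card W = CARD('a) ^ vec.dim W"
  using vec.basis_subspace_exists[OF assms] card_span_independent by metis

text \<open>A basis of \<open>T\<close> extends to a basis of the whole space; a set of size
  \<open>m\<close> in between spans the required subspace.\<close>

lemma subspace_extend_dim:
  fixes T :: "('a::field ^ 'n::finite) set"
  assumes "vec.subspace T" and "vec.dim T \<le> m" and "m \<le> CARD('n)"
  obtains U where "vec.subspace U" "vec.dim U = m" "T \<subseteq> U"
proof -
  obtain B where B: "vec.independent B" "vec.span B = T" "card B = vec.dim T"
    using vec.basis_subspace_exists[OF assms(1)] by metis
  obtain C where C: "B \<subseteq> C" "vec.independent C" "UNIV \<subseteq> vec.span C"
    using vec.maximal_independent_subset_extend[of B UNIV] B by auto
  have "card C = CARD('n)"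
    using C vec.dim_eq_card[of C UNIV] dim_UNIV_vec[where 'a='a and 'n='n]
    by (metis top.extremum_uniqueI vec.span_UNIV)
  then obtain E where E: "B \<subseteq> E" "E \<subseteq> C" "card E = m"
    using exists_subset_between[of B m C] assms B C vec.finiteI_independent by metis
  show ?thesis
  proof
    show "vec.subspace (vec.span E)" by simp
    show "vec.dim (vec.span E) = m"
      using E C vec.independent_mono by (metis vec.dim_span_eq_card_independent)
    show "T \<subseteq> vec.span E" using B E vec.span_mono by blast
  qed
qed

lemma exists_distinct_subspaces:
  assumes "1 \<le> m" and "m < CARD('n)"
  obtains A B :: "('a::field ^ 'n::finite) set"
  where "vec.subspace A" "vec.dim A = m" "vec.subspace B" "vec.dim B = m" "A \<noteq> B"
proof -
  obtain A :: "('a ^ 'n) set" where A: "vec.subspace A" "vec.dim A = m"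
    using subspace_extend_dim[of "{0 :: 'a ^ 'n}" m] assms by auto
  have "A \<noteq> UNIV" using A assms dim_UNIV_vec[where 'a='a and 'n='n] by auto
  then obtain x where x: "x \<notin> A" by auto
  obtain B where "vec.subspace B" "vec.dim B = m" "vec.span {x} \<subseteq> B"
    using subspace_extend_dim[of "vec.span {x}" m] assms vec.dim_le_card'[of "{x}"]
    by (auto simp del: vec.dim_singleton)
  moreover from this have "x \<in> B" by (meson insertI1 subsetD vec.span_base)
  ultimately show ?thesis using that A x by metis
qed

section \<open>Codewords as functions on vectors\<close>

text \<open>The zero vector represents no point of the projective space, hence the value 0
  there.\<close>

definition homogeneous :: "('a::field ^ 'n \<Rightarrow> 'f::zero) \<Rightarrow> bool" where
  "homogeneous F \<longleftrightarrow> F 0 = 0 \<and> (\<forall>a v. a \<noteq> 0 \<longrightarrow> F (a *s v) = F v)"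

text \<open>The number \<open>d\<close> is a vector dimension: the dual of \<open>pg_code k\<close>
  corresponds to \<open>d = k + 1\<close>.\<close>

definition dual_function :: "nat \<Rightarrow> ('a::{field,finite} ^ 'n::finite \<Rightarrow> 'f::field) \<Rightarrow> bool" where
  "dual_function d F \<longleftrightarrow>
    homogeneous F \<and> (\<forall>W. vec.subspace W \<and> vec.dim W = d \<longrightarrow> sum F W = 0)"

text \<open>The subspaces of dimension \<open>d\<close> between a subspace \<open>D\<close> of dimension \<open>d - 1\<close> and \<open>V\<close> form a
  pencil: they cover \<open>V - D\<close> once and \<open>D\<close> itself \<open>q + 1\<close> times, and \<open>q\<close> vanishes in the field
  of values.\<close>

lemma dual_function_sum_Suc:
  fixes F :: "'a::{field,finite} ^ 'n::finite \<Rightarrow> 'f::field"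
  assumes F: "dual_function d F" and q: "of_nat CARD('a) = (0::'f)"
    and W: "vec.subspace W" "vec.dim W = d" and d: "0 < d" and r: "r \<notin> W"
  shows "sum F (vec.span (insert r W)) = 0"
proof -
  obtain B where B: "vec.independent B" "vec.span B = W" "card B = d" "finite B"
    using vec.basis_subspace_exists[OF W(1)] W(2) by metis
  obtain a where a: "a \<in> B" using B d by fastforce
  define D where "D = vec.span (B - {a})"
  have D: "vec.subspace D" by (simp add: D_def)
  have indep: "vec.independent (B - {a})" using B vec.independent_mono by blast
  have "a \<notin> D" using a B(1) by (auto simp: D_def vec.dependent_def)
  have dim_D: "Suc (vec.dim D) = d"
    unfolding D_def using indep a B d by (simp add: vec.dim_eq_card_independent)
  have "vec.span (insert a D) = W"
  proof -
    have "vec.span (insert a D) = vec.span (insert a (B - {a}))"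
      by (simp only: D_def vec.span_insert vec.span_span)
    with a B show ?thesis by (simp add: insert_absorb)
  qed
  have DW: "D \<subseteq> W" unfolding D_def using B vec.span_mono[of "B - {a}" B] by auto
  have aW: "a \<in> W" using a B vec.span_base by blast
  have pencil: "(\<Sum>e\<in>D. \<Sum>s\<in>UNIV. F (e + s *s x)) = 0" if "x \<notin> D" for x
  proof -
    have "vec.dim (vec.span (insert x D)) = d"
      using that D dim_D by (simp add: vec.dim_insert vec.span_eq_iff[THEN iffD2])
    then show ?thesis using F sum_span_insert[OF D that, of F]
      by (simp add: dual_function_def)
  qed
  \<comment> \<open>The spans of \<open>D\<close> and \<open>a + t *s r\<close>, for all
    \<open>t\<close>, are the members of the pencil other than the span of \<open>D\<close> and
    \<open>r\<close>.\<close>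
  have nD: "a + t *s r \<notin> D" for t
  proof
    assume *: "a + t *s r \<in> D"
    then have "t *s r \<in> W" using DW aW W(1) vec.subspace_diff
      by (metis add_diff_cancel_left' subsetD)
    then have "inverse t *s (t *s r) \<in> W" using W(1) vec.subspace_scale by blast
    then have "t = 0" using r by (cases "t = 0") (simp_all add: vector_smult_assoc)
    then show False using * \<open>a \<notin> D\<close> by simp
  qed
  have "0 = (\<Sum>t\<in>UNIV. \<Sum>e\<in>D. \<Sum>s\<in>UNIV. F (e + s *s (a + t *s r)))"
    using pencil[OF nD] by simp
  also have "\<dots> = (\<Sum>e\<in>D. \<Sum>s\<in>UNIV. \<Sum>t\<in>UNIV. F (e + s *s a + (s * t) *s r))"
    by (subst sum.swap, rule sum.cong[OF refl], subst sum.swap)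
      (simp add: vec.scale_right_distrib vector_smult_assoc add.assoc)
  \<comment> \<open>For \<open>s = 0\<close> the inner sum is \<open>CARD('a)\<close> copies of
    \<open>F e\<close>, which is zero; for \<open>s\<close> nonzero, multiplication by
    \<open>s\<close> permutes the values of \<open>t\<close>.\<close>
  also have "\<dots> = (\<Sum>e\<in>D. \<Sum>s\<in>UNIV - {0}. \<Sum>t\<in>UNIV. F (e + s *s a + t *s r))"
  proof (rule sum.cong[OF refl])
    fix e
    have "(\<Sum>t\<in>UNIV. F (e + s *s a + (s * t) *s r)) = (\<Sum>t\<in>UNIV. F (e + s *s a + t *s r))"
      if "s \<noteq> 0" for s
      by (rule sum.reindex_bij_witness[of _ "\<lambda>t. t / s" "\<lambda>t. s * t"]) (use that in auto)
    then show "(\<Sum>s\<in>UNIV. \<Sum>t\<in>UNIV. F (e + s *s a + (s * t) *s r))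
        = (\<Sum>s\<in>UNIV - {0}. \<Sum>t\<in>UNIV. F (e + s *s a + t *s r))"
      using q by (subst sum.remove[of UNIV 0]) simp_all
  qed
  finally have 1: "(\<Sum>e\<in>D. \<Sum>s\<in>UNIV - {0}. \<Sum>t\<in>UNIV. F (e + s *s a + t *s r)) = 0" ..
  have 2: "(\<Sum>e\<in>D. \<Sum>t\<in>UNIV. F (e + t *s r)) = 0"
    using pencil r DW by blast
  have "sum F (vec.span (insert r W)) = (\<Sum>w\<in>W. \<Sum>t\<in>UNIV. F (w + t *s r))"
    by (rule sum_span_insert[OF W(1) r])
  also have "\<dots> = (\<Sum>e\<in>D. \<Sum>s\<in>UNIV. \<Sum>t\<in>UNIV. F (e + s *s a + t *s r))"
    using sum_span_insert[OF D \<open>a \<notin> D\<close>, of "\<lambda>w. \<Sum>t\<in>UNIV. F (w + t *s r)"]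
    by (simp add: \<open>vec.span (insert a D) = W\<close>)
  also have "\<dots> = (\<Sum>e\<in>D. \<Sum>t\<in>UNIV. F (e + t *s r))
      + (\<Sum>e\<in>D. \<Sum>s\<in>UNIV - {0}. \<Sum>t\<in>UNIV. F (e + s *s a + t *s r))"
    unfolding sum.distrib[symmetric]
    by (rule sum.cong[OF refl], subst sum.remove[of UNIV 0]) simp_all
  also have "\<dots> = 0"
    using 1 2 by simp
  finally show ?thesis .
qed

text \<open>This is the projection from \<open>r\<close> onto the hyperplane \<open>H\<close> of
  vectors with \<open>i\<close>-th coordinate 0, extended by zero. Its sum over \<open>W\<close> is
  the sum of \<open>F\<close> over the span of \<open>r\<close> and \<open>W \<inter> H\<close>.
  That span has dimension \<open>d\<close> unless \<open>W \<subseteq> H\<close>, when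
  \<open>dual_function_sum_Suc\<close> applies.\<close>

lemma dual_function_projection:
  fixes F :: "'a::{field,finite} ^ 'n::finite \<Rightarrow> 'f::field"
  assumes F: "dual_function d F" and q: "of_nat CARD('a) = (0::'f)"
    and r: "r $ i \<noteq> 0" "F r = 0" and d: "0 < d"
  shows "dual_function d (\<lambda>y. if y $ i = 0 then \<Sum>t\<in>UNIV. F (y + t *s r) else 0)"
    (is "dual_function d ?G")
  unfolding dual_function_def
proof (intro conjI allI impI)
  have hom: "F 0 = 0" "\<And>a v. a \<noteq> 0 \<Longrightarrow> F (a *s v) = F v"
    using F by (auto simp: dual_function_def homogeneous_def)
  show "homogeneous ?G"
    unfolding homogeneous_def
  proof (intro conjI allI impI)
    \<comment> \<open>The projection vanishes at 0 because the centre \<open>r\<close> is off the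
      support.\<close>
    have "F (t *s r) = 0" for t by (cases "t = 0") (simp_all add: hom r)
    then show "?G 0 = 0" by simp
    fix a :: 'a and v :: "'a ^ 'n" assume a: "a \<noteq> 0"
    have "(\<Sum>t\<in>UNIV. F (a *s v + t *s r)) = (\<Sum>t\<in>UNIV. F (v + t *s r))"
    proof (rule sum.reindex_bij_witness[of _ "\<lambda>t. a * t" "\<lambda>t. t / a"])
      fix t
      have "a *s v + t *s r = a *s (v + (t / a) *s r)"
        using a by (simp add: vec.scale_right_distrib vector_smult_assoc)
      then show "F (v + (t / a) *s r) = F (a *s v + t *s r)" using a hom by simp
    qed (use a in auto)
    with a show "?G (a *s v) = ?G v" by simp
  qed
  define H where "H = {v :: 'a ^ 'n. v $ i = 0}"
  have H: "vec.subspace H" by (auto simp: H_def vec.subspace_def)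
  fix W :: "('a ^ 'n) set" assume "vec.subspace W \<and> vec.dim W = d"
  then have W: "vec.subspace W" "vec.dim W = d" by auto
  have WH: "vec.subspace (W \<inter> H)" using W H by (simp add: vec.subspace_inter)
  have rWH: "r \<notin> W \<inter> H" using r by (simp add: H_def)
  have "sum ?G W = (\<Sum>y\<in>W \<inter> H. \<Sum>t\<in>UNIV. F (y + t *s r))"
    by (simp add: H_def sum.inter_restrict)
  also have "\<dots> = sum F (vec.span (insert r (W \<inter> H)))"
    by (rule sum_span_insert[OF WH rWH, symmetric])
  also have "\<dots> = 0"
  proof (cases "W \<subseteq> H")
    case True
    then have "W \<inter> H = W" by auto
    then show ?thesis using dual_function_sum_Suc[OF F q W d] rWH by simp
  next
    case False
    then obtain a where a: "a \<in> W" "a $ i \<noteq> 0" by (auto simp: H_def)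
    have "vec.span (insert a (W \<inter> H)) = W"
    proof (rule vec.span_subspace[OF _ _ W(1)])
      show "insert a (W \<inter> H) \<subseteq> W" using a by auto
      show "W \<subseteq> vec.span (insert a (W \<inter> H))"
      proof
        fix w assume w: "w \<in> W"
        have "w - (w $ i / a $ i) *s a \<in> W \<inter> H"
          using w a W by (simp add: H_def vec.subspace_diff vec.subspace_scale)
        then show "w \<in> vec.span (insert a (W \<inter> H))"
          unfolding vec.span_insert using vec.span_base by blast
      qed
    qed
    \<comment> \<open>Replacing \<open>a\<close> by \<open>r\<close> as the vector added to
      \<open>W \<inter> H\<close> keeps the dimension equal to \<open>d\<close>.\<close>
    moreover have "a \<notin> vec.span (W \<inter> H)" "r \<notin> vec.span (W \<inter> H)"
      unfolding vec.span_eq_iff[THEN iffD2, OF WH] using a rWH by (auto simp: H_def)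
    ultimately have "vec.dim (vec.span (insert r (W \<inter> H))) = d"
      using W(2) by (metis vec.dim_insert vec.dim_span)
    then show ?thesis using F vec.subspace_span unfolding dual_function_def by blast
  qed
  finally show "sum ?G W = 0" .
qed

section \<open>Codewords of minimal weight\<close>

text \<open>Supports are counted in vectors; this multiplies every weight by
  \<open>CARD('a) - 1\<close> and preserves minimality.\<close>

definition minimal_dual_function :: "nat \<Rightarrow> ('a::{field,finite} ^ 'n::finite \<Rightarrow> 'f::field) \<Rightarrow> bool" where
  "minimal_dual_function d F \<longleftrightarrow> dual_function d F \<and> (\<exists>v. F v \<noteq> 0) \<and>
    (\<forall>G :: 'a ^ 'n \<Rightarrow> 'f. dual_function d G \<and> (\<exists>v. G v \<noteq> 0) \<longrightarrow>
      card {v. F v \<noteq> 0} \<le> card {v. G v \<noteq> 0})"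

text \<open>The projection from \<open>r\<close> identifies a multiple of \<open>u\<close> with a
  multiple of \<open>v\<close>, so its support is too small and it vanishes. Its value at the image
  of \<open>w\<close> is the sum of all \<open>F (w + t *s r)\<close>, so another term has to cancel
  \<open>F w\<close>.\<close>

lemma minimal_dual_function_no_tangent:
  fixes F :: "'a::{field,finite} ^ 'n::finite \<Rightarrow> 'f::field"
  assumes F: "minimal_dual_function d F" and q: "of_nat CARD('a) = (0::'f)" and d: "0 < d"
    and uv: "F u \<noteq> 0" "F v \<noteq> 0" "r = \<alpha> *s u + \<beta> *s v"
    and r: "r \<noteq> 0" "F r = 0" and w: "F w \<noteq> 0"
  shows "\<exists>t. t \<noteq> 0 \<and> F (w + t *s r) \<noteq> 0"
proof -
  have dual: "dual_function d F" using F by (simp add: minimal_dual_function_def)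
  have hom: "F 0 = 0" "\<And>a v. a \<noteq> 0 \<Longrightarrow> F (a *s v) = F v"
    using dual by (auto simp: dual_function_def homogeneous_def)
  obtain i where i: "r $ i \<noteq> 0" using r(1) by (auto simp: vec_eq_iff)
  define G where "G y = (if y $ i = 0 then \<Sum>t\<in>UNIV. F (y + t *s r) else 0)" for y
  define \<pi> where "\<pi> v = v - (v $ i / r $ i) *s r" for v
  have G: "dual_function d G"
    unfolding G_def by (rule dual_function_projection[OF dual q i r(2) d])
  \<comment> \<open>Otherwise \<open>r\<close> would be zero or a nonzero multiple of a support
    vector.\<close>
  have \<alpha>: "\<alpha> \<noteq> 0" and \<beta>: "\<beta> \<noteq> 0"
    using uv r hom by (metis add_0 add_0_right vec.scale_zero_left)+
  have sub: "{y. G y \<noteq> 0} \<subseteq> \<pi> ` {v. F v \<noteq> 0}"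
  proof
    fix y assume "y \<in> {y. G y \<noteq> 0}"
    then have y: "y $ i = 0" "(\<Sum>t\<in>UNIV. F (y + t *s r)) \<noteq> 0"
      by (auto simp: G_def split: if_splits)
    then obtain t where "F (y + t *s r) \<noteq> 0" by (metis sum.neutral)
    moreover have "\<pi> (y + t *s r) = y" using y i by (simp add: \<pi>_def)
    ultimately show "y \<in> \<pi> ` {v. F v \<noteq> 0}" by force
  qed
  have G0: "G y = 0" for y
  proof (rule ccontr)
    assume "G y \<noteq> 0"
    then have "card {v. F v \<noteq> 0} \<le> card {v. G v \<noteq> 0}"
      using F G unfolding minimal_dual_function_def by blast
    also have "\<dots> \<le> card (\<pi> ` {v. F v \<noteq> 0})" by (rule card_mono[OF _ sub]) simp
    \<comment> \<open>Minimality leaves no room for two support vectors with the same image.\<close>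
    finally have inj: "inj_on \<pi> {v. F v \<noteq> 0}"
      by (metis card_image_le eq_card_imp_inj_on finite le_antisym)
    have "\<alpha> *s u = r + (- \<beta>) *s v" using uv(3) by simp
    then have "\<pi> (\<alpha> *s u) = \<pi> (r + (- \<beta>) *s v)" by simp
    also have "\<dots> = \<pi> ((- \<beta>) *s v)"
      using i by (simp add: \<pi>_def add_divide_distrib diff_divide_distrib vec.scale_left_diff_distrib
          vec.scale_left_distrib)
    finally have "\<alpha> *s u = (- \<beta>) *s v"
      using inj \<alpha> \<beta> hom(2)[of \<alpha> u] hom(2)[of "- \<beta>" v] uv(1,2) unfolding inj_on_def by simp
    then show False using uv(3) r(1) by simp
  qed
  \<comment> \<open>This is the parameter of \<open>w\<close> on its line: \<open>w\<close> is
    \<open>\<pi> w + s *s r\<close>.\<close>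
  define s where "s = w $ i / r $ i"
  have "(\<Sum>t\<in>UNIV. F (w + t *s r)) = (\<Sum>t\<in>UNIV. F (\<pi> w + t *s r))"
    by (rule sum.reindex_bij_witness[of _ "\<lambda>t. t - s" "\<lambda>t. t + s"])
      (auto simp: \<pi>_def s_def vec.scale_left_distrib algebra_simps)
  also have "\<dots> = 0" using G0[of "\<pi> w"] i by (simp add: G_def \<pi>_def)
  finally have "F w + (\<Sum>t\<in>UNIV - {0}. F (w + t *s r)) = 0"
    by (subst (asm) sum.remove[of UNIV 0]) simp_all
  then have "(\<Sum>t\<in>UNIV - {0}. F (w + t *s r)) \<noteq> 0" using w by auto
  then obtain t where "t \<in> UNIV - {0}" "F (w + t *s r) \<noteq> 0" by (metis sum.neutral)
  then show ?thesis by auto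
qed

text \<open>The absence of tangents shows that \<open>T\<close> is closed under adding multiples of
  a support vector (\<open>line\<close>). As elements of \<open>T\<close> are combinations of two
  support vectors, closure under addition follows by applying this twice.\<close>

lemma minimal_dual_function_secants_subspace:
  fixes F :: "'a::{field,finite} ^ 'n::finite \<Rightarrow> 'f::field"
  assumes F: "minimal_dual_function d F" and q: "of_nat CARD('a) = (0::'f)" and d: "0 < d"
  obtains T where "vec.subspace T" "{v. F v \<noteq> 0} \<subseteq> T"
    "\<And>w x. F w \<noteq> 0 \<Longrightarrow> x \<in> T \<Longrightarrow> x \<notin> vec.span {w} \<Longrightarrow> \<exists>b. F (x + b *s w) \<noteq> 0"
proof -
  have hom: "F 0 = 0" "\<And>a v. a \<noteq> 0 \<Longrightarrow> F (a *s v) = F v"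
    using F by (auto simp: minimal_dual_function_def dual_function_def homogeneous_def)
  \<comment> \<open>Equal \<open>u\<close> and \<open>v\<close> and zero coefficients are allowed,
    so 0 and the support itself are included.\<close>
  define T where "T = {\<alpha> *s u + \<beta> *s v | \<alpha> \<beta> u v. F u \<noteq> 0 \<and> F v \<noteq> 0}"
  have TI: "\<alpha> *s u + \<beta> *s v \<in> T" if "F u \<noteq> 0" "F v \<noteq> 0" for \<alpha> \<beta> u v
    using that by (auto simp: T_def)
  have supp_T: "v \<in> T" if "F v \<noteq> 0" for v
    using TI[OF that that, of 1 0] by simp
  have secant: "\<exists>b. F (x + b *s w) \<noteq> 0" if w: "F w \<noteq> 0" and x: "x \<in> T" "x \<noteq> 0" for w x
  proof (cases "F x = 0")
    case True
    obtain \<alpha> \<beta> u v where "F u \<noteq> 0" "F v \<noteq> 0" "x = \<alpha> *s u + \<beta> *s v"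
      using x by (auto simp: T_def)
    then obtain t where t: "t \<noteq> 0" "F (w + t *s x) \<noteq> 0"
      using minimal_dual_function_no_tangent[OF F q d _ _ _ x(2) True w] by blast
    have "x + inverse t *s w = inverse t *s (w + t *s x)"
      using t by (simp add: vec.scale_right_distrib vector_smult_assoc add.commute)
    then have "F (x + inverse t *s w) \<noteq> 0" using t hom by simp
    then show ?thesis ..
  next
    case False
    then show ?thesis by (intro exI[of _ 0]) simp
  qed
  have line: "x + a *s w \<in> T" if w: "F w \<noteq> 0" and x: "x \<in> T" for a w x
  proof (cases "x = 0")
    case True
    then show ?thesis using TI[OF w w, of a 0] by simp
  next
    case False
    then obtain b where b: "F (x + b *s w) \<noteq> 0" using secant w x by blast
    \<comment> \<open>With \<open>x + b *s w\<close> in the support, the whole line lies on a secant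
      through \<open>w\<close>.\<close>
    have "x + a *s w = 1 *s (x + b *s w) + (a - b) *s w"
      by (simp add: vec.scale_left_diff_distrib)
    then show ?thesis using TI[OF b w] by metis
  qed
  show ?thesis
  proof
    show "vec.subspace T"
      unfolding vec.subspace_def
    proof (intro conjI ballI allI)
      obtain v where "F v \<noteq> 0" using F by (auto simp: minimal_dual_function_def)
      then show "0 \<in> T" using TI[of v v 0 0] by simp
      fix x y assume x: "x \<in> T" and "y \<in> T"
      then obtain \<alpha> \<beta> u v where y: "F u \<noteq> 0" "F v \<noteq> 0" "y = \<alpha> *s u + \<beta> *s v"
        by (auto simp: T_def)
      have "(x + \<alpha> *s u) + \<beta> *s v \<in> T" using line x y by blast
      then show "x + y \<in> T" using y by (simp add: add.assoc)
    next
      fix c x assume "x \<in> T"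
      then obtain \<alpha> \<beta> u v where x: "F u \<noteq> 0" "F v \<noteq> 0" "x = \<alpha> *s u + \<beta> *s v"
        by (auto simp: T_def)
      then have "c *s x = (c * \<alpha>) *s u + (c * \<beta>) *s v"
        by (simp add: vec.scale_right_distrib vector_smult_assoc)
      then show "c *s x \<in> T" using TI x by simp
    qed
    show "{v. F v \<noteq> 0} \<subseteq> T" using supp_T by blast
    show "\<exists>b. F (x + b *s w) \<noteq> 0" if "F w \<noteq> 0" "x \<in> T" "x \<notin> vec.span {w}" for w x
      using secant that vec.span_zero by metis
  qed
qed

text \<open>Each vector of \<open>T\<close> off the line of \<open>w\<close> is
  \<open>v - b *s w\<close> for some support vector \<open>v\<close> other than \<open>w\<close>.
  Leaving out \<open>w\<close> saves \<open>CARD('a)\<close> pairs, exactly the number of vectors on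
  the line of \<open>w\<close>.\<close>

lemma card_secants_subspace_le:
  fixes F :: "'a::{field,finite} ^ 'n::finite \<Rightarrow> 'f::field"
  assumes T: "vec.subspace T" and w: "F w \<noteq> 0" "w \<noteq> 0"
    and secant: "\<And>x. x \<in> T \<Longrightarrow> x \<notin> vec.span {w} \<Longrightarrow> \<exists>b. F (x + b *s w) \<noteq> 0"
  shows "CARD('a) ^ vec.dim T \<le> CARD('a) * card {v. F v \<noteq> 0}"
proof -
  let ?S = "{v. F v \<noteq> 0} - {w}" and ?L = "vec.span {w}"
  have "T \<subseteq> ?L \<union> (\<lambda>(v, b). v - b *s w) ` (?S \<times> UNIV)"
  proof
    fix x assume x: "x \<in> T"
    show "x \<in> ?L \<union> (\<lambda>(v, b). v - b *s w) ` (?S \<times> UNIV)"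
    proof (cases "x \<in> ?L")
      case False
      then obtain b where b: "F (x + b *s w) \<noteq> 0" using secant x by blast
      have "x + b *s w \<noteq> w"
      proof
        assume "x + b *s w = w"
        then have "x = (1 - b) *s w"
          by (simp add: vec.scale_left_diff_distrib eq_diff_eq)
        then show False using False by (auto simp: vec.span_singleton)
      qed
      with b have "(x + b *s w, b) \<in> ?S \<times> UNIV" by simp
      then have "(\<lambda>(v, b). v - b *s w) (x + b *s w, b) \<in> (\<lambda>(v, b). v - b *s w) ` (?S \<times> UNIV)"
        by (rule imageI)
      then show ?thesis by simp
    qed simp
  qed
  then have "card T \<le> card (?L \<union> (\<lambda>(v, b). v - b *s w) ` (?S \<times> UNIV))"
    by (intro card_mono) auto
  also have "\<dots> \<le> card ?L + card ((\<lambda>(v, b). v - b *s w) ` (?S \<times> (UNIV :: 'a set)))"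
    by (rule card_Un_le)
  also have "card ((\<lambda>(v, b). v - b *s w) ` (?S \<times> (UNIV :: 'a set))) \<le> card (?S \<times> (UNIV :: 'a set))"
    by (rule card_image_le) simp
  also have "card (?S \<times> (UNIV :: 'a set)) = (card {v. F v \<noteq> 0} - 1) * CARD('a)"
    using w by (simp add: card_cartesian_product)
  also have "card ?L = CARD('a)"
    using w by (simp add: card_subspace)
  also have "CARD('a) + (card {v. F v \<noteq> 0} - 1) * CARD('a) = CARD('a) * card {v. F v \<noteq> 0}"
  proof -
    \<comment> \<open>A nonempty support makes the truncated subtraction exact.\<close>
    have "card {v. F v \<noteq> 0} \<noteq> 0" using w by auto
    then show ?thesis by (cases "card {v. F v \<noteq> 0}") simp_all
  qed
  finally show ?thesis using T by (simp add: card_subspace)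
qed

text \<open>The competitor is the difference of the characteristic functions of two distinct
  \<open>m\<close>-dimensional subspaces: each of them meets every \<open>d\<close>-dimensional subspace in a nonzero
  subspace, whose cardinality vanishes in the field of values.\<close>

lemma minimal_dual_function_card_le:
  fixes F :: "'a::{field,finite} ^ 'n::finite \<Rightarrow> 'f::field"
  assumes F: "minimal_dual_function d F" and q: "of_nat CARD('a) = (0::'f)"
    and m: "m + d = CARD('n) + 1" "1 \<le> m" "m < CARD('n)"
  shows "card {v. F v \<noteq> 0} < 2 * CARD('a) ^ m"
proof -
  obtain A B :: "('a ^ 'n) set" where A: "vec.subspace A" "vec.dim A = m"
    and B: "vec.subspace B" "vec.dim B = m" and AB: "A \<noteq> B"
    using exists_distinct_subspaces[OF m(2,3)] by metis
  define G :: "'a ^ 'n \<Rightarrow> 'f" where "G v = of_bool (v \<in> A) - of_bool (v \<in> B)" for v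
  have scale: "a *s v \<in> U \<longleftrightarrow> v \<in> U" if "vec.subspace U" "a \<noteq> 0" for U a and v :: "'a ^ 'n"
    using that vec.subspace_scale[of U "a *s v" "inverse a"] vec.subspace_scale[of U v a]
    by (auto simp: vector_smult_assoc)
  have sum0: "(\<Sum>v\<in>W. of_bool (v \<in> U)) = (0::'f)"
    if U: "vec.subspace U" "vec.dim U = m" and W: "vec.subspace W" "vec.dim W = d"
    for U W :: "('a ^ 'n) set"
  proof -
    \<comment> \<open>As \<open>m + d\<close> exceeds \<open>CARD('n)\<close> by one, the dimension
      formula forces a nonzero intersection.\<close>
    have "vec.dim {x + y |x y. x \<in> U \<and> y \<in> W} \<le> CARD('n)"
      unfolding dim_UNIV_vec[where 'a='a, symmetric] by (rule vec.dim_subset) simp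
    then have "0 < vec.dim (U \<inter> W)"
      using vec.dim_sums_Int[OF U(1) W(1)] U(2) W(2) m by linarith
    then have "of_nat (card (U \<inter> W)) = (0::'f)"
      using U W q by (simp add: card_subspace vec.subspace_inter)
    moreover have "W \<inter> {v. v \<in> U} = U \<inter> W" by auto
    ultimately show ?thesis by (simp add: sum_of_bool_eq)
  qed
  have "dual_function d G"
    using A B sum0 vec.subspace_0
    by (auto simp: dual_function_def homogeneous_def G_def scale sum_subtractf)
  moreover have "\<exists>v. G v \<noteq> 0" using AB by (auto simp: G_def)
  ultimately have "card {v. F v \<noteq> 0} \<le> card {v. G v \<noteq> 0}"
    using F by (auto simp: minimal_dual_function_def)
  \<comment> \<open>The inequality is strict because 0 lies in both subspaces, where
    \<open>G\<close> vanishes.\<close>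
  also have "\<dots> < card (A \<union> B)"
    by (rule psubset_card_mono) (use A B vec.subspace_0 in \<open>auto simp: G_def\<close>)
  also have "\<dots> \<le> card A + card B" by (rule card_Un_le)
  also have "\<dots> = 2 * CARD('a) ^ m" using A B by (simp add: card_subspace)
  finally show ?thesis .
qed

text \<open>The lower bound from the lines through \<open>w\<close> and the upper bound from the
  competitor leave \<open>T\<close> dimension at most \<open>m + 1\<close>; \<open>T\<close> is then
  enlarged to that dimension.\<close>

lemma minimal_dual_function_support:
  fixes F :: "'a::{field,finite} ^ 'n::finite \<Rightarrow> 'f::field"
  assumes F: "minimal_dual_function d F" and q: "of_nat CARD('a) = (0::'f)"
    and m: "m + d = CARD('n) + 1" "1 \<le> m" "m < CARD('n)"
  obtains U where "vec.subspace U" "vec.dim U = m + 1" "{v. F v \<noteq> 0} \<subseteq> U"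
proof -
  have d: "0 < d" using m by linarith
  obtain T where T: "vec.subspace T" "{v. F v \<noteq> 0} \<subseteq> T"
    and secant: "\<And>w x. F w \<noteq> 0 \<Longrightarrow> x \<in> T \<Longrightarrow> x \<notin> vec.span {w} \<Longrightarrow> \<exists>b. F (x + b *s w) \<noteq> 0"
    using minimal_dual_function_secants_subspace[OF F q d] by metis
  obtain w where w: "F w \<noteq> 0" using F by (auto simp: minimal_dual_function_def)
  have "w \<noteq> 0"
    using w F by (auto simp: minimal_dual_function_def dual_function_def homogeneous_def)
  then have "CARD('a) ^ vec.dim T \<le> CARD('a) * card {v. F v \<noteq> 0}"
    using card_secants_subspace_le[of T F w] T(1) secant w by blast
  also have "\<dots> < CARD('a) * (2 * CARD('a) ^ m)"
    using minimal_dual_function_card_le[OF F q m] CARD_field_ge_2[where 'a='a] by simp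
  \<comment> \<open>The factor 2 is absorbed by the order of the field, so the binary case is
    covered too.\<close>
  also have "\<dots> \<le> CARD('a) * (CARD('a) * CARD('a) ^ m)"
    using CARD_field_ge_2[where 'a='a] by simp
  also have "\<dots> = CARD('a) ^ (m + 2)" by simp
  finally have "vec.dim T < m + 2"
    using CARD_field_ge_2[where 'a='a] by (simp only: power_strict_increasing_iff)
  then show ?thesis
    using subspace_extend_dim[OF T(1), of "m + 1"] m T(2) that by (metis Suc_eq_plus1 Suc_leI
        add_2_eq_Suc' less_Suc_eq_le subset_trans)
qed

section \<open>Points and vectors\<close>

text \<open>Meaningful for nonzero \<open>v\<close> only, since the span of 0 is not a
  point.\<close>

definition vec_point :: "'a::field ^ 'n::finite \<Rightarrow> ('a, 'n) pg_point" where
  "vec_point v = Abs_pg_point (vec.span {v})"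

definition point_function ::
  "'f::zero ^ ('a::{field,finite}, 'n::finite) pg_point \<Rightarrow> 'a ^ 'n \<Rightarrow> 'f" where
  "point_function c v = (if v = 0 then 0 else c $ vec_point v)"

lemma Rep_vec_point: "v \<noteq> 0 \<Longrightarrow> Rep_pg_point (vec_point v) = vec.span {v}"
  unfolding vec_point_def by (subst Abs_pg_point_inverse) auto

lemma vec_point_eq_iff:
  assumes "v \<noteq> 0"
  shows "vec_point v = P \<longleftrightarrow> v \<in> Rep_pg_point P"
proof
  assume "vec_point v = P"
  then show "v \<in> Rep_pg_point P" using Rep_vec_point[OF assms] by (auto intro: vec.span_base)
next
  assume v: "v \<in> Rep_pg_point P"
  have P: "vec.subspace (Rep_pg_point P)" "vec.dim (Rep_pg_point P) = 1"
    using Rep_pg_point[of P] by auto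
  have "vec.span {v} = Rep_pg_point P"
    by (rule vec.subspace_dim_equal) (use P v assms in \<open>auto intro: vec.span_minimal[THEN subsetD]\<close>)
  then show "vec_point v = P" by (simp add: vec_point_def Rep_pg_point_inverse)
qed

lemma vec_point_scale: "a \<noteq> 0 \<Longrightarrow> v \<noteq> 0 \<Longrightarrow> vec_point (a *s v) = vec_point v"
  by (simp add: vec_point_eq_iff Rep_vec_point vec.span_singleton)

lemma ex_vec_point: "\<exists>v. v \<noteq> 0 \<and> vec_point v = P"
proof -
  have "vec.dim (Rep_pg_point P) = 1" using Rep_pg_point[of P] by auto
  then have "\<not> Rep_pg_point P \<subseteq> {0}" by (metis vec.dim_eq_0 zero_neq_one)
  then show ?thesis using vec_point_eq_iff by blast
qed

text \<open>Nonzero vectors are grouped by the point they span; each point has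
  \<open>CARD('a) - 1\<close> of them.\<close>

lemma sum_vec_point:
  fixes g :: "('a::{field,finite}, 'n::finite) pg_point \<Rightarrow> 'b::semiring_1"
  assumes W: "vec.subspace W"
  shows "(\<Sum>v\<in>W - {0}. g (vec_point v)) = of_nat (CARD('a) - 1) * (\<Sum>P | Rep_pg_point P \<subseteq> W. g P)"
proof -
  have "(\<Sum>v\<in>W - {0}. g (vec_point v))
      = (\<Sum>P | Rep_pg_point P \<subseteq> W. \<Sum>v | v \<in> W - {0} \<and> vec_point v = P. g (vec_point v))"
    by (rule sum.group[symmetric])
      (use W in \<open>auto simp: Rep_vec_point intro: vec.span_minimal[THEN subsetD]\<close>)
  also have "\<dots> = (\<Sum>P | Rep_pg_point P \<subseteq> W. of_nat (CARD('a) - 1) * g P)"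
  proof (rule sum.cong[OF refl])
    fix P assume "P \<in> {P. Rep_pg_point P \<subseteq> W}"
    then have eq: "{v. v \<in> W - {0} \<and> vec_point v = P} = Rep_pg_point P - {0}"
      using vec_point_eq_iff by auto
    have P: "vec.subspace (Rep_pg_point P)" "vec.dim (Rep_pg_point P) = 1"
      using Rep_pg_point[of P] by auto
    have "(\<Sum>v | v \<in> W - {0} \<and> vec_point v = P. g (vec_point v))
        = (\<Sum>v | v \<in> W - {0} \<and> vec_point v = P. g P)"
      by (rule sum.cong) auto
    also have "\<dots> = of_nat (CARD('a) - 1) * g P"
      unfolding eq using P by (simp add: card_subspace vec.subspace_0)
    finally show "(\<Sum>v | v \<in> W - {0} \<and> vec_point v = P. g (vec_point v))
        = of_nat (CARD('a) - 1) * g P" .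
  qed
  finally show ?thesis by (simp add: sum_distrib_left)
qed

lemma homogeneous_point_function: "homogeneous (point_function c)"
  by (auto simp: homogeneous_def point_function_def vec_point_scale)

text \<open>The coordinate at a point is read off at a chosen representative, and homogeneity makes
  the choice immaterial. Thus competitors among functions come from vectors indexed by
  points.\<close>

lemma homogeneous_imp_point_function:
  fixes G :: "'a::{field,finite} ^ 'n::finite \<Rightarrow> 'f::zero"
  assumes "homogeneous G"
  obtains c where "G = point_function c"
proof
  let ?c = "\<chi> P. G (SOME v. v \<noteq> 0 \<and> vec_point v = P)"
  show "G = point_function ?c"
  proof
    fix v
    show "G v = point_function ?c v"
    proof (cases "v = 0")
      case True
      then show ?thesis using assms by (simp add: point_function_def homogeneous_def)
    next
      case False
      define u where "u = (SOME u. u \<noteq> 0 \<and> vec_point u = vec_point v)"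
      have u: "u \<noteq> 0" "vec_point u = vec_point v"
        using someI_ex[OF ex_vec_point[of "vec_point v"]] by (auto simp: u_def)
      then have "u \<in> vec.span {v}" using False by (simp add: vec_point_eq_iff Rep_vec_point)
      then obtain a where "u = a *s v" by (auto simp: vec.span_singleton)
      then have "G u = G v" using assms u by (auto simp: homogeneous_def)
      then show ?thesis using False by (simp add: point_function_def u_def)
    qed
  qed
qed

text \<open>The number \<open>CARD('a) - 1\<close> of vectors per point becomes -1 in the field of
  values.\<close>

lemma sum_point_function:
  fixes c :: "'f::field ^ ('a::{field,finite}, 'n::finite) pg_point"
  assumes W: "vec.subspace W" and q: "of_nat CARD('a) = (0::'f)"
  shows "sum (point_function c) W = - (\<Sum>P | Rep_pg_point P \<subseteq> W. c $ P)"
proof -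
  have "sum (point_function c) W = (\<Sum>v\<in>W - {0}. point_function c v)"
    by (rule sum.mono_neutral_right) (auto simp: point_function_def)
  also have "\<dots> = (\<Sum>v\<in>W - {0}. c $ vec_point v)"
    by (rule sum.cong) (auto simp: point_function_def)
  finally show ?thesis using sum_vec_point[OF W, of "\<lambda>P. c $ P"] q by (simp add: of_nat_diff)
qed

lemma card_point_function:
  fixes c :: "'f::field ^ ('a::{field,finite}, 'n::finite) pg_point"
  shows "card {v. point_function c v \<noteq> 0} = (CARD('a) - 1) * weight c"
proof -
  have "card {v. point_function c v \<noteq> 0} = (\<Sum>v\<in>UNIV - {0}. of_bool (c $ vec_point v \<noteq> 0))"
    by (auto simp: point_function_def sum_of_bool_eq intro: arg_cong[where f = card])
  also have "\<dots> = (CARD('a) - 1) * (\<Sum>P\<in>UNIV. of_bool (c $ P \<noteq> 0))"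
    using sum_vec_point[OF vec.subspace_UNIV, of "\<lambda>P. of_bool (c $ P \<noteq> 0) :: nat"] by simp
  also have "(\<Sum>P\<in>UNIV. of_bool (c $ P \<noteq> 0)) = weight c"
    by (simp add: sum_of_bool_eq weight_def supp_def)
  finally show ?thesis .
qed

text \<open>The vectors orthogonal to \<open>c\<close> form a subspace, so testing generators
  suffices.\<close>

lemma dual_code_span: "c \<in> dual_code (vec.span X) \<longleftrightarrow> (\<forall>v\<in>X. (\<Sum>i\<in>UNIV. c $ i * v $ i) = 0)"
proof
  assume "c \<in> dual_code (vec.span X)"
  then show "\<forall>v\<in>X. (\<Sum>i\<in>UNIV. c $ i * v $ i) = 0"
    by (auto simp: dual_code_def intro: vec.span_base)
next
  have "vec.subspace {v. (\<Sum>i\<in>UNIV. c $ i * v $ i) = 0}"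
    by (auto simp: vec.subspace_def distrib_left sum.distrib mult.left_commute
        sum_distrib_left[symmetric])
  moreover assume "\<forall>v\<in>X. (\<Sum>i\<in>UNIV. c $ i * v $ i) = 0"
  ultimately have "vec.span X \<subseteq> {v. (\<Sum>i\<in>UNIV. c $ i * v $ i) = 0}"
    by (intro vec.span_minimal) auto
  then show "c \<in> dual_code (vec.span X)" by (auto simp: dual_code_def)
qed

text \<open>The product with an incidence row is the sum of the coordinates over the points of a
  subspace, up to sign the sum of \<open>point_function c\<close> over its vectors.\<close>

lemma dual_pg_code_iff:
  fixes c :: "'f::field ^ ('a::{field,finite}, 'n::finite) pg_point"
  assumes q: "of_nat CARD('a) = (0::'f)"
  shows "c \<in> dual_code (pg_code k) \<longleftrightarrow> dual_function (k + 1) (point_function c)"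
proof -
  have "(\<Sum>P\<in>UNIV. c $ P * incidence_row S $ P) = (\<Sum>P\<in>S. c $ P)" for S
    by (simp add: incidence_row_def if_distrib[where f = "\<lambda>x. _ * x"] sum.If_cases)
  then show ?thesis
    unfolding pg_code_def dual_code_span dual_function_def pg_subspaces_def
    by (auto simp: homogeneous_point_function sum_point_function[OF _ q])
qed

lemma point_function_eq_0_iff:
  fixes c :: "'f::zero ^ ('a::{field,finite}, 'b::finite) pg_point"
  shows "(\<forall>v. point_function c v = 0) \<longleftrightarrow> c = 0"
proof
  assume *: "\<forall>v. point_function c v = 0"
  show "c = 0"
  proof (rule vec_eq_iff[THEN iffD2, rule_format])
    fix P :: "('a, 'b) pg_point"
    obtain v :: "'a ^ 'b" where "v \<noteq> 0" "vec_point v = P" using ex_vec_point by blast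
    with *[rule_format, of v] show "c $ P = 0 $ P" by (simp add: point_function_def)
  qed
qed (simp add: point_function_def)

lemma minimal_weight_codeword_imp_minimal_dual_function:
  fixes c :: "'f::field ^ ('a::{field,finite}, 'n::finite) pg_point"
  assumes c: "minimal_weight_codeword (dual_code (pg_code k)) c"
    and q: "of_nat CARD('a) = (0::'f)"
  shows "minimal_dual_function (k + 1) (point_function c)"
  unfolding minimal_dual_function_def
proof (intro conjI allI impI)
  show "dual_function (k + 1) (point_function c)"
    using c dual_pg_code_iff[OF q] by (auto simp: minimal_weight_codeword_def)
  show "\<exists>v. point_function c v \<noteq> 0"
    using c by (metis minimal_weight_codeword_def point_function_eq_0_iff)
  fix G :: "'a ^ 'n \<Rightarrow> 'f" assume G: "dual_function (k + 1) G \<and> (\<exists>v. G v \<noteq> 0)"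
  then obtain c' where c': "G = point_function c'"
    using homogeneous_imp_point_function by (metis dual_function_def)
  with G have "c' \<in> dual_code (pg_code k)" "c' \<noteq> 0"
    using dual_pg_code_iff[OF q] point_function_eq_0_iff[of c'] by auto
  then have "weight c \<le> weight c'" using c by (simp add: minimal_weight_codeword_def)
  then show "card {v. point_function c v \<noteq> 0} \<le> card {v. G v \<noteq> 0}"
    by (simp add: c' card_point_function)
qed

theorem theorem4p4:
  fixes p h q n k :: nat
    and c :: "'f::{field,finite} ^ ('a::{field,finite}, 'n::finite) pg_point"
  assumes "prime p" and "q = p ^ h"
    and "CARD('f) = p" and "CARD('a) = q"
    and "CARD('n) = n + 1"
    and "n \<ge> 3" and "1 \<le> k" and "k \<le> n - 1"
    and "minimal_weight_codeword
          (dual_code (pg_code k :: ('f ^ ('a, 'n) pg_point) set)) c"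
  shows "\<exists>S \<in> pg_subspaces (n - k + 1). supp c \<subseteq> S"
proof -
  \<comment> \<open>A positive exponent makes \<open>p\<close> divide \<open>q\<close>, so
    \<open>q\<close> vanishes in the field of values.\<close>
  have "h \<noteq> 0" using CARD_field_ge_2[where 'a='a] assms(2,4) by (cases h) auto
  then have q0: "of_nat CARD('a) = (0::'f)"
    using of_nat_CARD_eq_0[where 'f='f] assms(2-4) by simp
  \<comment> \<open>The instance is \<open>m = n - k + 1\<close> and \<open>d = k + 1\<close>, with
    sum \<open>n + 2\<close>; the projective dimension of \<open>U\<close> is
    \<open>n - k + 1\<close>.\<close>
  obtain U where U: "vec.subspace U" "vec.dim U = (n - k + 1) + 1"
    and sub: "{v. point_function c v \<noteq> 0} \<subseteq> U"
    by (rule minimal_dual_function_support[OF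
          minimal_weight_codeword_imp_minimal_dual_function[OF assms(9) q0] q0, of "n - k + 1"])
      (use assms(5-8) in auto)
  have "supp c \<subseteq> {P. Rep_pg_point P \<subseteq> U}"
  proof
    fix P assume P: "P \<in> supp c"
    obtain v where v: "v \<noteq> 0" "vec_point v = P" using ex_vec_point by blast
    with P have "v \<in> U" using sub by (auto simp: supp_def point_function_def)
    then show "P \<in> {P. Rep_pg_point P \<subseteq> U}"
      using v Rep_vec_point[of v] U(1) vec.span_minimal[of "{v}" U] by auto
  qed
  then show ?thesis using U by (auto simp: pg_subspaces_def)
qed

end
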